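(* Let $\alpha>0$ and $z_0>0$. If $f:[0,\infty)\to(0,\infty)$ is a solution of $$\frac{f''(x)}{1+f'(x)^2}+\frac{f'(x)}{x}=\frac{\alpha}{f(x)},\qquad f(0)=z_0,\quad f'(0)=0,$$ then $$f(x)<\left(\frac{\alpha+2}{\alpha}\right)f(r)-\sqrt{r^2+\frac{4f(r)^2}{\alpha^2}-x^2}$$ for all $0\leq x<r$ and all $r>0$. As a consequence, the lowest value $f(0)$ of $f$ satisfies $$f(0)<\left(\frac{\alpha+2}{\alpha}\right)f(r)-\sqrt{r^2+\frac{4f(r)^2}{\alpha^2}}$$ for all $r>0$.
   Context: The differential equation is understood for $x>0$, with $f$ smooth on $[0,\infty)$. (Geometrically, the surface $(x\cos\theta,x\sin\theta,f(x))$ obtained by rotating the graph of $f$ about the $z$-axis is an $\alpha$-singular minimal surface with density vector $(0,0,1)$ meeting the $z$-axis, i.e. its mean curvature $H$ and Gauss map $N$ satisfy $2H=\alpha\langle N,(0,0,1)\rangle/z$.) *)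

theory Defs
  imports "HOL-Analysis.Analysis"
begin

text \<open>
  A function on the closed half-line is a total function of which only the values on \<open>{0..}\<close>
  matter. The derivative is taken within \<open>{0..}\<close>: at \<open>0\<close> it is the right-hand derivative, and at
  \<open>x > 0\<close> it is the ordinary two-sided derivative.
\<close>

definition hl_deriv :: "(real \<Rightarrow> real) \<Rightarrow> real \<Rightarrow> real" where
  "hl_deriv f x = vector_derivative f (at x within {0..})"

definition hl_smooth :: "(real \<Rightarrow> real) \<Rightarrow> bool" where
  "hl_smooth f \<longleftrightarrow> (\<forall>n. (hl_deriv ^^ n) f differentiable_on {0..})"

text \<open>The equation is imposed only for \<open>x > 0\<close>, since \<open>f' x / x\<close> is singular at the origin.\<close>

definition rotational_singular_minimal_sol :: "real \<Rightarrow> real \<Rightarrow> (real \<Rightarrow> real) \<Rightarrow> bool" where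
  "rotational_singular_minimal_sol \<alpha> z0 f \<longleftrightarrow>
     f \<in> {0..} \<rightarrow> {0<..} \<and> hl_smooth f \<and>
     (\<forall>x>0. hl_deriv (hl_deriv f) x / (1 + (hl_deriv f x)\<^sup>2) + hl_deriv f x / x = \<alpha> / f x) \<and>
     f 0 = z0 \<and> hl_deriv f 0 = 0"

end

(* Write p = f' and w = f p / x. The smooth initial data force w to tend to \<alpha>/2 at 0, and where
   w < \<alpha>/2 the equation makes w increase; hence w \<ge> \<alpha>/2, and then w > \<alpha>/2 for x > 0. In terms
   of the angle \<psi> of the profile curve (tan \<psi> = p), the inequality w > \<alpha>/2 says exactly that
   sin \<psi> / x is strictly decreasing. On the lower arc of the circle with centre
   (0, (\<alpha>+2) f(r) / \<alpha>) through (r, f(r)) the same quotient is constant, equal to the inverse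
   radius, and w(r) > \<alpha>/2 says that f is steeper than the arc at r. So f is steeper than the arc
   on all of (0, r), hence below it. *)

theory Submission
  imports Defs
begin

lemma has_real_derivative_hl_deriv:
  assumes "f differentiable_on {0..}" "0 \<le> x"
  shows "(f has_real_derivative hl_deriv f x) (at x within {0..})"
  using assms
  by (simp add: differentiable_on_def hl_deriv_def has_real_derivative_iff_has_vector_derivative
      vector_derivative_works)

text \<open>\<open>p\<close> and \<open>q\<close> stand for f' and f''. Continuity of
  \<open>q\<close> lets the equation, imposed only for x > 0, be passed to the limit at the
  origin.\<close>

locale singular_profile =
  fixes \<alpha> :: real and f p q :: "real \<Rightarrow> real"
  assumes alpha_pos: "\<alpha> > 0"
    and f_pos: "0 \<le> x \<Longrightarrow> f x > 0"
    and f_deriv: "0 \<le> x \<Longrightarrow> (f has_real_derivative p x) (at x within {0..})"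
    and p_deriv: "0 \<le> x \<Longrightarrow> (p has_real_derivative q x) (at x within {0..})"
    and q_cont: "continuous_on {0..} q"
    and ode: "0 < x \<Longrightarrow> q x / (1 + (p x)\<^sup>2) + p x / x = \<alpha> / f x"
    and p_0: "p 0 = 0"
begin

lemma f_deriv_at: "0 < x \<Longrightarrow> (f has_real_derivative p x) (at x)"
  using f_deriv[of x] at_within_interior[of x "{0..}"] by simp

lemma p_deriv_at: "0 < x \<Longrightarrow> (p has_real_derivative q x) (at x)"
  using p_deriv[of x] at_within_interior[of x "{0..}"] by simp

lemma f_cont: "continuous_on {0..} f"
  by (rule DERIV_continuous_on[OF f_deriv]) simp

lemma p_cont: "continuous_on {0..} p"
  by (rule DERIV_continuous_on[OF p_deriv]) simp

lemma q_eq: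
  assumes "0 < x"
  shows "q x = (1 + (p x)\<^sup>2) * (\<alpha> / f x - p x / x)"
proof -
  have "1 + (p x)\<^sup>2 \<noteq> 0"
    using zero_le_power2[of "p x"] by linarith
  moreover have "q x / (1 + (p x)\<^sup>2) = \<alpha> / f x - p x / x"
    using ode[OF assms] by linarith
  ultimately show ?thesis
    by (simp add: nonzero_divide_eq_eq mult.commute)
qed

text \<open>The value at 0 is the limit of \<open>f x * p x / x\<close> there, computed in
  \<open>f_q_0\<close>, so that \<open>w\<close> is continuous up to the origin.\<close>

definition w :: "real \<Rightarrow> real" where
  "w x = (if x = 0 then \<alpha> / 2 else f x * p x / x)"

lemma p_div_tendsto: "((\<lambda>x. p x / x) \<longlongrightarrow> q 0) (at 0 within {0..})"
  using p_deriv[of 0] p_0 by (simp add: has_field_derivative_iff)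

text \<open>Let x tend to 0 in the equation: both terms on the left tend to \<open>q 0\<close>, the
  second because \<open>p 0 = 0\<close> makes \<open>p x / x\<close> a difference quotient.\<close>

lemma f_q_0: "f 0 * q 0 = \<alpha> / 2"
proof -
  let ?F = "at (0::real) within {0..}"
  have f: "(f \<longlongrightarrow> f 0) ?F" and p: "(p \<longlongrightarrow> 0) ?F" and q: "(q \<longlongrightarrow> q 0) ?F"
    using f_cont p_cont q_cont p_0 by (force simp: continuous_on_def)+
  have "((\<lambda>x. q x / (1 + (p x)\<^sup>2) + p x / x) \<longlongrightarrow> q 0 / (1 + 0\<^sup>2) + q 0) ?F"
    by (intro tendsto_intros p q p_div_tendsto) simp
  moreover have "((\<lambda>x. \<alpha> / f x) \<longlongrightarrow> \<alpha> / f 0) ?F"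
    using f_pos[of 0] by (intro tendsto_intros f) simp
  moreover have "\<forall>\<^sub>F x in ?F. q x / (1 + (p x)\<^sup>2) + p x / x = \<alpha> / f x"
    using ode by (auto simp: eventually_at intro!: exI[of _ 1])
  ultimately have "\<alpha> / f 0 = q 0 / (1 + 0\<^sup>2) + q 0"
    by (intro tendsto_unique[OF _ _ Lim_transform_eventually])
      (auto simp: at_within_Ici_at_right)
  then show ?thesis
    using f_pos[of 0] by (simp add: field_simps)
qed

lemma w_cont: "continuous_on {0..} w"
  unfolding continuous_on_def
proof
  fix x :: real assume "x \<in> {0..}"
  then consider "x = 0" | "x > 0" by fastforce
  then show "(w \<longlongrightarrow> w x) (at x within {0..})"
  proof cases
    case 1
    have "(f \<longlongrightarrow> f 0) (at 0 within {0..})"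
      using f_cont by (auto simp: continuous_on_def)
    then have "((\<lambda>x. f x * (p x / x)) \<longlongrightarrow> w 0) (at 0 within {0..})"
      using tendsto_mult[OF _ p_div_tendsto] f_q_0 by (fastforce simp: w_def)
    then show ?thesis
      unfolding 1
      by (rule Lim_transform_eventually) (auto simp: w_def eventually_at intro!: exI[of _ 1])
  next
    case 2
    have "((\<lambda>x. f x * p x / x) \<longlongrightarrow> w x) (at x)"
      using 2 DERIV_isCont[OF f_deriv_at[OF 2]] DERIV_isCont[OF p_deriv_at[OF 2]]
      by (simp add: w_def isCont_def tendsto_divide tendsto_mult)
    moreover have "\<forall>\<^sub>F y in at x. f y * p y / y = w y"
      using 2 by (intro eventually_mono[OF eventually_at_in_open'[of "{0<..}"]]) (auto simp: w_def)
    ultimately have "(w \<longlongrightarrow> w x) (at x)"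
      by (rule Lim_transform_eventually)
    then show ?thesis
      by (rule Lim_at_imp_Lim_at_within)
  qed
qed

text \<open>The equation eliminates \<open>q\<close>, so the sign of w' can be read off from
  \<open>p\<close> and \<open>w\<close> alone.\<close>

lemma w_deriv:
  assumes "0 < x"
  shows "(w has_real_derivative ((p x)\<^sup>2 + (1 + (p x)\<^sup>2) * (\<alpha> - w x) - w x) / x) (at x)"
proof -
  have "f x * (\<alpha> / f x - p x / x) = \<alpha> - w x"
    using assms f_pos[of x] by (simp add: w_def right_diff_distrib)
  then have "f x * q x = (1 + (p x)\<^sup>2) * (\<alpha> - w x)"
    using assms by (simp add: q_eq mult.left_commute)
  moreover have "((p x)\<^sup>2 + f x * q x - w x) / x = ((p x * p x + q x * f x) * x - f x * p x) / (x * x)"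
    using assms by (simp add: w_def power2_eq_square divide_simps)
  moreover have "((\<lambda>x. f x * p x / x) has_real_derivative
      ((p x * p x + q x * f x) * x - f x * p x) / (x * x)) (at x)"
    using assms DERIV_divide[OF DERIV_mult[OF f_deriv_at p_deriv_at] DERIV_ident] by fastforce
  ultimately have "((\<lambda>x. f x * p x / x) has_real_derivative
      ((p x)\<^sup>2 + (1 + (p x)\<^sup>2) * (\<alpha> - w x) - w x) / x) (at x)"
    by simp
  then show ?thesis
    by (rule has_field_derivative_transform_within_open[where S = "{0<..}"])
      (use assms in \<open>auto simp: w_def\<close>)
qed

text \<open>A barrier argument: after the last point \<open>a\<close> before \<open>x\<close> where
  \<open>w\<close> is at least \<alpha>/2, it stays below this value, hence is nondecreasing and
  cannot have dropped.\<close>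

lemma w_ge:
  assumes "0 \<le> x"
  shows "\<alpha> / 2 \<le> w x"
proof (rule ccontr)
  assume less: "\<not> \<alpha> / 2 \<le> w x"
  define S where "S = {y \<in> {0..x}. \<alpha> / 2 \<le> w y}"
  have cont: "continuous_on {0..x} w"
    using w_cont by (rule continuous_on_subset) auto
  have "closed S"
    using continuous_closed_preimage[OF cont, of "{\<alpha> / 2..}"] by (simp add: S_def vimage_def Int_def)
  moreover have "bounded S"
    by (rule bounded_subset[of "{0..x}"]) (auto simp: S_def)
  \<comment> \<open>The chosen value of \<open>w\<close> at 0 starts the barrier argument.\<close>
  moreover have "0 \<in> S"
    using assms by (simp add: S_def w_def)
  ultimately obtain a where a: "a \<in> S" "\<And>y. y \<in> S \<Longrightarrow> y \<le> a"
    using compact_attains_sup[of S] by (auto simp: compact_eq_bounded_closed)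
  have "a < x"
    using a(1) less by (auto simp: S_def order_le_less)
  then have "w a \<le> w x"
  proof (rule DERIV_nonneg_imp_increasing_open[OF less_imp_le])
    fix y assume y: "a < y" "y < x"
    then have "y \<notin> S"
      using a(2)[of y] by force
    with y a(1) have "0 < y" "w y < \<alpha> / 2"
      by (auto simp: S_def)
    \<comment> \<open>The numerator of w' is p^2 (1 + \<alpha>) + \<alpha> - (2 + p^2) w, so this
      bound leaves at least p^2 (1 + \<alpha>/2).\<close>
    moreover from this have "(2 + (p y)\<^sup>2) * w y \<le> (2 + (p y)\<^sup>2) * (\<alpha> / 2)"
      by (intro mult_left_mono) auto
    moreover have "0 \<le> (p y)\<^sup>2 * \<alpha>"
      using alpha_pos by simp
    ultimately have "0 \<le> (p y)\<^sup>2 + (1 + (p y)\<^sup>2) * (\<alpha> - w y) - w y"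
      using zero_le_power2[of "p y"] by (simp only: algebra_simps)
    with w_deriv[OF \<open>0 < y\<close>] \<open>0 < y\<close> show "\<exists>d. (w has_real_derivative d) (at y) \<and> 0 \<le> d"
      by (intro exI conjI) auto
  next
    show "continuous_on {a..x} w"
      using cont a(1) by (auto intro: continuous_on_subset simp: S_def)
  qed
  with a(1) less show False
    by (auto simp: S_def)
qed

lemma p_pos:
  assumes "0 < x"
  shows "0 < p x"
proof -
  have "0 < w x"
    using w_ge[OF less_imp_le[OF assms]] alpha_pos by linarith
  then have "0 < f x * p x / x"
    using assms by (simp add: w_def)
  then show ?thesis
    using assms f_pos[OF less_imp_le[OF assms]] by (auto simp: zero_less_divide_iff zero_less_mult_iff)
qed

text \<open>If \<open>w\<close> touched \<alpha>/2 at some x > 0, its derivative there would be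
  positive, as p > 0, and \<open>w\<close> would lie below \<alpha>/2 just to the left, against
  \<open>w_ge\<close>.\<close>

lemma w_gt:
  assumes "0 < x"
  shows "\<alpha> / 2 < w x"
proof (rule ccontr)
  assume "\<not> \<alpha> / 2 < w x"
  then have eq: "w x = \<alpha> / 2"
    using w_ge[of x] assms by simp
  have "((p x)\<^sup>2 + (1 + (p x)\<^sup>2) * (\<alpha> - w x) - w x) / x = (p x)\<^sup>2 * (1 + \<alpha> / 2) / x"
    unfolding eq by (simp add: algebra_simps)
  also have "\<dots> > 0"
    using p_pos[OF assms] alpha_pos assms by simp
  finally obtain d where d: "d > 0" "\<And>h. 0 < h \<Longrightarrow> h < d \<Longrightarrow> w (x - h) < w x"
    using DERIV_pos_inc_left[OF w_deriv[OF assms]] by auto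
  define h where "h = min d x / 2"
  have h: "0 < h" "h < d" "0 \<le> x - h"
    using d(1) assms by (auto simp: h_def min_def)
  show False
    using d(2)[OF h(1,2)] w_ge[OF h(3)] eq by linarith
qed

text \<open>The quantity \<open>x\<^sup>2 + (x / p x)\<^sup>2\<close> is \<open>(x / sin \<psi>)\<^sup>2\<close>, the squared radius of the circle centred
  on the axis that is tangent to the profile at \<open>x\<close>.\<close>

lemma tangent_radius_strict_mono:
  assumes "0 < x" "x < y"
  shows "x\<^sup>2 + (x / p x)\<^sup>2 < y\<^sup>2 + (y / p y)\<^sup>2"
  using \<open>x < y\<close>
proof (rule DERIV_pos_imp_increasing)
  fix t assume "x \<le> t" "t \<le> y"
  then have t: "0 < t" using assms by simp
  have p: "0 < p t" and f: "0 < f t"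
    using p_pos f_pos t by auto
  have d: "((\<lambda>x. x\<^sup>2 + (x / p x)\<^sup>2) has_real_derivative
      2 * t + 2 * (t / p t) * ((p t - t * q t) / (p t)\<^sup>2)) (at t)"
    using p by (auto intro!: derivative_eq_intros p_deriv_at t) (simp add: power2_eq_square ac_simps)
  \<comment> \<open>Up to the positive factor \<open>2 * t / p t ^ 3\<close> this is the derivative
    in \<open>d\<close>; substituting the equation for \<open>q\<close> shows that its sign is that
    of \<open>2 * w t - \<alpha>\<close>.\<close>
  have "p t ^ 3 + (p t - t * q t) = (1 + (p t)\<^sup>2) * (2 * p t - t * \<alpha> / f t)"
    using t by (simp add: q_eq algebra_simps power2_eq_square power3_eq_cube)
  moreover have "2 * p t - t * \<alpha> / f t = t / f t * (2 * w t - \<alpha>)"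
    using t f by (simp add: w_def field_simps)
  moreover have "2 * t + 2 * (t / p t) * ((p t - t * q t) / (p t)\<^sup>2)
      = 2 * t / p t ^ 3 * (p t ^ 3 + (p t - t * q t))"
    using p by (simp add: distrib_left power2_eq_square power3_eq_cube)
  ultimately have "2 * t + 2 * (t / p t) * ((p t - t * q t) / (p t)\<^sup>2)
      = 2 * t / p t ^ 3 * ((1 + (p t)\<^sup>2) * (t / f t * (2 * w t - \<alpha>)))"
    by simp
  also have "\<dots> > 0"
    using p t f w_gt[OF t] by (intro mult_pos_pos divide_pos_pos) (auto simp: add_pos_nonneg)
  finally show "\<exists>D. ((\<lambda>x. x\<^sup>2 + (x / p x)\<^sup>2) has_real_derivative D) (at t) \<and> 0 < D"
    using d by blast
qed

lemma below_circle:
  assumes "0 \<le> x" "x < r"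
  shows "f x < ((\<alpha> + 2) / \<alpha>) * f r - sqrt (r\<^sup>2 + 4 * (f r)\<^sup>2 / \<alpha>\<^sup>2 - x\<^sup>2)"
proof -
  \<comment> \<open>The squared radius of the comparison circle: its centre lies 2 f(r) / \<alpha>
    above the point (r, f(r)).\<close>
  define R where "R = r\<^sup>2 + 4 * (f r)\<^sup>2 / \<alpha>\<^sup>2"
  have r: "0 < r" and fr: "0 < f r" and pr: "0 < p r"
    using assms f_pos[of r] p_pos[of r] by auto
  have pos: "0 < R - t\<^sup>2" if "0 \<le> t" "t \<le> r" for t
  proof -
    have "t\<^sup>2 \<le> r\<^sup>2" using that by (simp add: power_mono)
    moreover have "0 < 4 * (f r)\<^sup>2 / \<alpha>\<^sup>2" using fr alpha_pos by simp
    ultimately show ?thesis unfolding R_def by linarith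
  qed
  \<comment> \<open>This is \<open>w r > \<alpha> / 2\<close> rearranged; it makes the circle
    tangent to the profile at \<open>r\<close> smaller than the comparison circle.\<close>
  have "r / p r < 2 * f r / \<alpha>"
    using w_gt[OF r] r pr alpha_pos by (simp add: w_def field_simps)
  then have "(r / p r)\<^sup>2 < (2 * f r / \<alpha>)\<^sup>2"
    using r pr by (intro power_strict_mono) auto
  then have R: "r\<^sup>2 + (r / p r)\<^sup>2 < R"
    by (simp add: R_def power_divide power_mult_distrib)
  \<comment> \<open>Up to the constant height of the centre, this function is \<open>f\<close> minus
    the lower arc; at \<open>r\<close> it equals that height.\<close>
  have "f x + sqrt (R - x\<^sup>2) < f r + sqrt (R - r\<^sup>2)"
    using \<open>x < r\<close>
  \<comment> \<open>Only interior points are tested: when x = 0, both \<open>f\<close> and the arc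
    have slope 0 at the left end.\<close>
  proof (rule DERIV_pos_imp_increasing_open)
    fix t assume "x < t" "t < r"
    then have t: "0 < t" "t \<le> r" using assms by auto
    \<comment> \<open>The tangent radius grows with \<open>t\<close>, so it stays below the radius
      of the comparison circle; equivalently, \<open>p t\<close> exceeds the slope of the
      arc.\<close>
    have "(t / p t)\<^sup>2 < R - t\<^sup>2"
      using tangent_radius_strict_mono[OF \<open>0 < t\<close> \<open>t < r\<close>] R by linarith
    then have "t / p t < sqrt (R - t\<^sup>2)"
      by (rule real_less_rsqrt)
    then have "0 < p t - t / sqrt (R - t\<^sup>2)"
      using p_pos[OF t(1)] pos[of t] t by (simp add: field_simps)
    moreover have "((\<lambda>x. f x + sqrt (R - x\<^sup>2)) has_real_derivative p t - t / sqrt (R - t\<^sup>2)) (at t)"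
      using pos[of t] t by (auto intro!: derivative_eq_intros f_deriv_at simp: field_simps)
    ultimately show "\<exists>D. ((\<lambda>x. f x + sqrt (R - x\<^sup>2)) has_real_derivative D) (at t) \<and> 0 < D"
      by blast
  next
    have "continuous_on {x..r} f"
      using f_cont assms by (auto intro: continuous_on_subset)
    then show "continuous_on {x..r} (\<lambda>x. f x + sqrt (R - x\<^sup>2))"
      by (intro continuous_intros)
  qed
  moreover have "sqrt (R - r\<^sup>2) = 2 * f r / \<alpha>"
    using fr alpha_pos by (simp add: R_def real_sqrt_divide real_sqrt_mult)
  moreover have "((\<alpha> + 2) / \<alpha>) * f r = f r + 2 * f r / \<alpha>"
    using alpha_pos by (simp add: field_simps)
  ultimately show ?thesis
    by (simp add: R_def)
qed

end

lemma singular_profile_of_sol: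
  assumes "\<alpha> > 0" "rotational_singular_minimal_sol \<alpha> z0 f"
  shows "singular_profile \<alpha> f (hl_deriv f) (hl_deriv (hl_deriv f))"
proof -
  have smooth: "(hl_deriv ^^ n) f differentiable_on {0..}" for n
    using assms(2) by (simp add: rotational_singular_minimal_sol_def hl_smooth_def)
  \<comment> \<open>Differentiability of the second derivative supplies the continuity of
    \<open>q\<close>.\<close>
  have diff: "f differentiable_on {0..}" "hl_deriv f differentiable_on {0..}"
      "hl_deriv (hl_deriv f) differentiable_on {0..}"
    using smooth[of 0] smooth[of 1] smooth[of 2] by (simp_all add: numeral_2_eq_2)
  show ?thesis
    using assms diff
    by unfold_locales (auto simp: rotational_singular_minimal_sol_def
        intro: has_real_derivative_hl_deriv differentiable_imp_continuous_on)
qed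

theorem theorem4p1:
  fixes \<alpha> z0 :: real and f :: "real \<Rightarrow> real"
  assumes "\<alpha> > 0" and "z0 > 0"
    and "rotational_singular_minimal_sol \<alpha> z0 f"
  shows "(\<forall>r>0. \<forall>x. 0 \<le> x \<and> x < r \<longrightarrow>
            f x < ((\<alpha> + 2) / \<alpha>) * f r - sqrt (r\<^sup>2 + 4 * (f r)\<^sup>2 / \<alpha>\<^sup>2 - x\<^sup>2)) \<and>
         (\<forall>r>0. f 0 < ((\<alpha> + 2) / \<alpha>) * f r - sqrt (r\<^sup>2 + 4 * (f r)\<^sup>2 / \<alpha>\<^sup>2))"
proof -
  interpret singular_profile \<alpha> f "hl_deriv f" "hl_deriv (hl_deriv f)"
    using assms(1,3) by (rule singular_profile_of_sol)
  show ?thesis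
    using below_circle below_circle[of 0] by simp
qed

end
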